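(* Let $m\ge 1$ and let $\mathfrak{S}^{(m)}$ be the set of all permutations (of all lengths $n\ge 0$) having no ascending subsequence of length $m+1$. Then, as formal power series in $t$, $$\sum_{\tau\in\mathfrak{S}^{(m)}}\frac{t^{2|\tau|}}{|\tau|!^2}=\det\left(I_{i-j}\right)_{1\le i,j\le m},$$ where for $i\in\mathbb{Z}$ $$I_i=\sum_{n\ge\max(0,-i)}\frac{t^{2n+i}}{n!\,(n+i)!}.$$
   Context: For a permutation $\tau=\tau(1)\cdots\tau(n)$ of $\{1,\dots,n\}$, $|\tau|=n$ denotes its length; the empty permutation (length $0$) is included. An ascending subsequence of $\tau$ of length $k$ is a $k$-tuple $(\tau(i_1),\dots,\tau(i_k))$ with $i_1<\cdots<i_k$ and $\tau(i_1)<\cdots<\tau(i_k)$. *)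

theory Defs
  imports
    "HOL-Computational_Algebra.Formal_Power_Series"
    "HOL-Combinatorics.Multiset_Permutations"
    "HOL-Library.Sublist"
    "HOL-Analysis.Infinite_Sum"
    "Jordan_Normal_Form.Determinant"
begin

text \<open>A permutation of \<open>{1..n}\<close> is represented by its one-line word, a list of length \<open>n\<close>;
  this keeps permutations of different lengths apart. The subsequences of a word, as tuples of
  values, are its (not necessarily contiguous) sublists.\<close>

definition has_ascending_subseq :: "nat \<Rightarrow> nat list \<Rightarrow> bool" where
  "has_ascending_subseq k \<tau> \<longleftrightarrow> (\<exists>xs. subseq xs \<tau> \<and> length xs = k \<and> sorted_wrt (<) xs)"

definition perms_avoiding :: "nat \<Rightarrow> nat list set" where
  "perms_avoiding m =
     {\<tau>. \<exists>n. \<tau> \<in> permutations_of_set {1..n} \<and> \<not> has_ascending_subseq (m + 1) \<tau>}"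

text \<open>Infinite sums of formal power series are taken in the metric on \<^typ>\<open>rat fps\<close>, whose
  convergence is eventual stabilisation of every coefficient. The exponent \<open>2n+i\<close> and the factorial
  argument \<open>n+i\<close> are nonnegative for \<open>n \<ge> max 0 (-i)\<close>, so \<^const>\<open>nat\<close> does not truncate.\<close>

definition I_series :: "int \<Rightarrow> rat fps" where
  "I_series i = (\<Sum>\<^sub>\<infinity> n \<in> {n::nat. int n \<ge> max 0 (- i)}.
     fps_const (1 / (fact n * fact (nat (int n + i)))) * fps_X ^ nat (2 * int n + i))"

text \<open>An infinite sum has the value \<open>0\<close> by convention when it diverges; the following shows
  that this does not happen in \<^const>\<open>I_series\<close>.\<close>

lemma has_sum_fps:
  fixes f :: "'b \<Rightarrow> 'a :: {comm_monoid_add, group_add} fps"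
  assumes fin: "\<And>k. finite {x \<in> A. fps_nth (f x) k \<noteq> 0}"
  shows "(f has_sum Abs_fps (\<lambda>k. \<Sum>x | x \<in> A \<and> fps_nth (f x) k \<noteq> 0. fps_nth (f x) k)) A"
  unfolding has_sum_def tendsto_fps_iff
proof
  fix k
  have "fps_nth (sum f F) k = (\<Sum>x | x \<in> A \<and> fps_nth (f x) k \<noteq> 0. fps_nth (f x) k)"
    if F: "finite F" "{x \<in> A. fps_nth (f x) k \<noteq> 0} \<subseteq> F" "F \<subseteq> A" for F
    unfolding fps_sum_nth by (rule sum.mono_neutral_right) (use F in auto)
  then show "\<forall>\<^sub>F F in finite_subsets_at_top A.
      fps_nth (sum f F) k =
      fps_nth (Abs_fps (\<lambda>k. \<Sum>x | x \<in> A \<and> fps_nth (f x) k \<noteq> 0. fps_nth (f x) k)) k"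
    unfolding eventually_finite_subsets_at_top fps_nth_Abs_fps
    by (intro exI[of _ "{x \<in> A. fps_nth (f x) k \<noteq> 0}"]) (use fin in auto)
qed

lemma I_series_has_sum:
  "((\<lambda>n. fps_const (1 / (fact n * fact (nat (int n + i)))) * fps_X ^ nat (2 * int n + i))
     has_sum I_series i) {n::nat. int n \<ge> max 0 (- i)}"
proof -
  let ?f = "\<lambda>n. fps_const (1 / (fact n * fact (nat (int n + i))) :: rat) *
                 fps_X ^ nat (2 * int n + i)"
  have "finite {n \<in> {n::nat. int n \<ge> max 0 (- i)}. fps_nth (?f n) k \<noteq> 0}" for k
    by (rule finite_subset[of _ "{..k + nat \<bar>i\<bar>}"]) (auto split: if_splits)
  then have "?f summable_on {n::nat. int n \<ge> max 0 (- i)}"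
    using has_sum_fps[of "{n::nat. int n \<ge> max 0 (- i)}" ?f] by (auto simp: summable_on_def)
  then show ?thesis
    unfolding I_series_def by (rule has_sum_infsum)
qed

end

theory Submission
  imports Defs "HOL-Computational_Algebra.Formal_Laurent_Series"
begin

text \<open>
  Inserting the values of a permutation in increasing order grows a partition by Fomin's local rules
  (the Robinson--Schensted correspondence). Its path is recorded by a ballot word, whose number of
  distinct letters is the length of a longest ascending subsequence. Deletion inverts the insertion
  step, given the box lost by the final shape \<open>h\<close>. Hence the number of permutations of length
  \<open>n\<close> with a given ballot word satisfies the same recursion as \<open>n! det(1/(h\<^sub>i - i + j)!)\<close>.

  It remains to sum this determinant over the ballot words with letters below \<open>m\<close>. As it
  is alternating in \<open>h\<^sub>i - i\<close>, it vanishes whenever a step would leave the set of partitions, so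
  the sum may be extended to all words. There every term of the Leibniz expansion has an exponential
  generating function that factors over the letters, and the factors are the \<open>I\<close>-series.
\<close>

subsection \<open>Growth of ballot words\<close>

text \<open>
  Words list the columns to which the boxes of a growing partition are added, the most recent box
  first. The heights of the columns are the letter counts, so all suffixes of a ballot word have
  weakly decreasing counts.
\<close>

primrec ballot :: "nat list \<Rightarrow> bool" where
  "ballot [] = True"
| "ballot (c # u) = (ballot u \<and> antimono (count_list (c # u)))"

definition removable :: "nat list \<Rightarrow> nat \<Rightarrow> bool" where
  "removable w e \<longleftrightarrow> count_list w (Suc e) < count_list w e"

text \<open>
  Insertion of a new maximum with \<open>k\<close> entries to its left (in the reversed permutation) adds a box to
  the first empty column and then propagates by Fomin's local rules: the new word is always one box
  ahead of the old one, in the column returned as second component. When both words would add their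
  box to that column, the box of the new word moves one row up, that is, to the first
  column of the same height. \<open>word_delete\<close> runs this backwards from a given extra box.
\<close>

fun word_insert :: "nat list \<Rightarrow> nat \<Rightarrow> nat list \<times> nat" where
  "word_insert u 0 = (let e = LEAST j. j \<notin> set u in (e # u, e))"
| "word_insert (c # u) (Suc k) =
     (let (w, e) = word_insert u k; d = (LEAST j. count_list w j = count_list w e)
      in if c = e then (d # w, d) else (c # w, e))"
| "word_insert [] (Suc k) = ([], 0)"

fun word_delete :: "nat list \<Rightarrow> nat \<Rightarrow> nat list \<times> nat" where
  "word_delete [] e = ([], 0)"
| "word_delete (d # w) e =
     (if d \<noteq> e then let (u, k) = word_delete w e in (d # u, Suc k)
      else if d \<notin> set w then (w, 0)
      else let c = (GREATEST j. count_list w j = count_list w d); (u, k) = word_delete w c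
           in (c # u, Suc k))"

section \<open>Insertion and deletion as mutually inverse maps on ballot words\<close>

lemma ballot_antimono: "ballot u \<Longrightarrow> antimono (count_list u)"
  by (cases u) (auto simp: antimono_def)

lemma ballot_drop: "ballot u \<Longrightarrow> ballot (drop k u)"
  by (induction u arbitrary: k) (auto simp: drop_Cons split: nat.split)

lemma antimono_nat_iff: "antimono (f :: nat \<Rightarrow> nat) \<longleftrightarrow> (\<forall>i. f (Suc i) \<le> f i)"
  by (metis antimonoD antimono_iff_le_Suc)

lemma ex_not_in_list: "\<exists>j::nat. j \<notin> set u"
  using ex_new_if_finite[OF infinite_UNIV_nat, of "set u"] by auto

text \<open>Raising column \<open>c\<close> by one can only spoil its comparison with columns to the
  left, so a box may be added exactly to the first column of a given height.\<close>

lemma antimono_Cons_iff: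
  fixes u :: "nat list"
  assumes "antimono (count_list u)"
  shows "antimono (count_list (c # u)) \<longleftrightarrow> (\<forall>j<c. count_list u c < count_list u j)"
proof
  assume L: "antimono (count_list (c # u))"
  show "\<forall>j<c. count_list u c < count_list u j"
  proof (intro allI impI)
    fix j assume "j < c"
    then have "count_list (c # u) c \<le> count_list (c # u) j"
      using antimonoD[OF L, of j c] by (simp del: count_list.simps)
    then show "count_list u c < count_list u j"
      using \<open>j < c\<close> by (cases "c = j") auto
  qed
next
  assume R: "\<forall>j<c. count_list u c < count_list u j"
  have *: "count_list u (Suc i) \<le> count_list u i" for i
    using assms by (simp add: antimonoD)
  show "antimono (count_list (c # u))"
    unfolding antimono_nat_iff
  proof
    fix i show "count_list (c # u) (Suc i) \<le> count_list (c # u) i"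
      using *[of i] R[rule_format, of i] by (auto simp: Suc_le_eq)
  qed
qed

text \<open>The columns of one height form an interval. This lemma and \<open>Greatest_level\<close>
  identify its two ends, between which a box jumps when it is bumped or unbumped.\<close>

lemma Least_level:
  fixes f :: "nat \<Rightarrow> nat"
  assumes "antimono f" "\<forall>j<d. f d < f j"
  shows "(LEAST j. f j = f d) = d"
proof (rule Least_equality)
  fix y assume "f y = f d"
  then show "d \<le> y"
    using assms(2) by (intro leI) force
qed simp

lemma Greatest_level:
  fixes f :: "nat \<Rightarrow> nat"
  assumes "antimono f" "f (Suc e) < f e"
  shows "(GREATEST j. f j = f e) = e"
proof (rule Greatest_equality)
  fix y assume "f y = f e"
  then have "\<not> Suc e \<le> y"
    using assms by (metis antimonoD leD)
  then show "y \<le> e" by simp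
qed simp

text \<open>Induction along the recursion with the whole conjunction as invariant. The counts say
  that the new shape exceeds the old one by a box in column \<open>e\<close>;
  \<open>removable\<close> makes that column the last one of its height, so the
  \<open>GREATEST\<close> in \<open>word_delete\<close> undoes the \<open>LEAST\<close> in
  \<open>word_insert\<close>.\<close>

lemma word_insert_correct:
  assumes "ballot u" "k \<le> length u" "word_insert u k = (w, e)"
  shows "ballot w" "\<And>j. count_list w j = count_list (e # u) j" "length w = Suc (length u)"
        "removable w e" "word_delete w e = (u, k)"
proof -
  have "ballot w \<and> (\<forall>j. count_list w j = count_list (e # u) j) \<and> length w = Suc (length u) \<and>
        removable w e \<and> word_delete w e = (u, k)"
    using assms
  proof (induction u k arbitrary: w e rule: word_insert.induct)
    case (1 u)
    define f where "f = (LEAST j. j \<notin> set u)"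
    have f: "f \<notin> set u"
      unfolding f_def by (rule LeastI_ex) (rule ex_not_in_list)
    have less: "j \<in> set u" if "j < f" for j
      using that not_less_Least unfolding f_def by blast
    have we: "w = f # u" "e = f"
      using 1 by (auto simp: f_def Let_def)
    have am: "antimono (count_list u)"
      using 1 ballot_antimono by blast
    have f0: "count_list u f = 0"
      using f by simp
    have "ballot w"
      using 1 am f0 less unfolding we by (simp add: antimono_Cons_iff del: count_list.simps)
        (metis count_list_0_iff gr0I)
    moreover have "removable w e"
      using antimonoD[OF am, of f "Suc f"] f0 by (simp add: removable_def we)
    ultimately show ?case
      using f by (simp add: we)
  next
    case (2 c u k)
    obtain v f where vf: "word_insert u k = (v, f)" by fastforce
    have IH: "ballot v" "\<And>j. count_list v j = count_list (f # u) j"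
      "length v = Suc (length u)" "removable v f" "word_delete v f = (u, k)"
      using 2(1)[OF _ _ vf] 2(2,3) by auto
    have lu: "ballot u" and ac: "antimono (count_list (c # u))"
      using 2 by auto
    have au: "antimono (count_list u)" and av: "antimono (count_list v)"
      using lu IH ballot_antimono by auto
    show ?case
    proof (cases "c = f")
      case True
      define d where "d = (LEAST j. count_list v j = count_list v f)"
      have d: "count_list v d = count_list v f"
        unfolding d_def by (rule LeastI[of _ f]) simp
      have dl: "count_list v d < count_list v j" if "j < d" for j
        using antimonoD[OF av, of j d] that not_less_Least[of j] d unfolding d_def
        by (metis le_neq_implies_less less_imp_le)
      have we: "w = d # v" "e = d"
        using 2(4) vf True by (auto simp: d_def Let_def)
      \<comment> \<open>This separates bumping from a fresh insertion: \<open>word_delete\<close>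
        stops as soon as the removed letter does not occur in the rest of the word.\<close>
      have pos: "d \<in> set v"
        by (metis IH(2) True count_list.simps(2) count_list_0_iff d nat.distinct(1) add_is_0 one_neq_zero)
      have "ballot w"
        using IH(1) dl av unfolding we by (simp add: antimono_Cons_iff del: count_list.simps)
      moreover have "(GREATEST j. count_list v j = count_list v d) = c"
        using Greatest_level[OF av] IH(4) True by (simp add: d removable_def)
      moreover have "removable w e"
        using antimonoD[OF av, of d "Suc d"] by (simp add: removable_def we)
      moreover have "count_list w j = count_list (e # c # u) j" for j
        using IH(2)[of j] True by (simp add: we)
      ultimately show ?thesis
        using IH pos True by (simp add: we)
    next
      case False
      have we: "w = c # v" "e = f"
        using 2(4) vf False by auto
      have "count_list v c < count_list v j" if "j < c" for j
        using ac au that IH(2)[of c] IH(2)[of j] False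
        by (auto simp: antimono_Cons_iff simp del: count_list.simps(2) split: if_splits)
           (auto simp add: less_Suc_eq)
      then have "ballot w"
        using IH(1) av unfolding we by (simp add: antimono_Cons_iff del: count_list.simps)
      moreover have "removable w e"
        using antimonoD[OF ac, of f "Suc f"] IH(2)[of f] IH(2)[of "Suc f"] False
        by (auto simp: removable_def we split: if_splits)
      ultimately show ?thesis
        using IH False by (auto simp: we)
    qed
  qed simp
  then show "ballot w" "\<And>j. count_list w j = count_list (e # u) j" "length w = Suc (length u)"
        "removable w e" "word_delete w e = (u, k)" by auto
qed

lemma removable_in_set: "removable w e \<Longrightarrow> e \<in> set w"
  by (rule ccontr) (simp add: removable_def)

text \<open>The converse of \<open>word_insert_correct\<close>. Together they match the pairs
  \<open>(u, k)\<close> with \<open>u\<close> ballot and \<open>k \<le> length u\<close> with the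
  pairs \<open>(w, e)\<close> where \<open>w\<close> is ballot, nonempty and \<open>e\<close> is
  removable.\<close>

lemma word_delete_correct:
  assumes "ballot w" "removable w e" "word_delete w e = (u, k)"
  shows "ballot u" "\<And>j. count_list w j = count_list (e # u) j" "k \<le> length u"
        "word_insert u k = (w, e)"
proof -
  have "ballot u \<and> (\<forall>j. count_list w j = count_list (e # u) j) \<and> k \<le> length u \<and> word_insert u k = (w, e)"
    using assms
  proof (induction w e arbitrary: u k rule: word_delete.induct)
    case (1 e)
    then show ?case by (simp add: removable_def)
  next
    case (2 d w e)
    have lw: "ballot w" and ad: "antimono (count_list (d # w))"
      using 2 by auto
    have aw: "antimono (count_list w)"
      using lw ballot_antimono by auto
    have dl: "\<forall>j<d. count_list w d < count_list w j"
      using ad aw antimono_Cons_iff by blast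
    show ?case
    proof (cases "d = e")
      case False
      obtain v l where vl: "word_delete w e = (v, l)" by fastforce
      have uk: "u = d # v" "k = Suc l"
        using 2 False vl by auto
      have "removable w e"
        using 2(4) False by (auto simp: removable_def split: if_splits)
      then have IH: "ballot v" "\<And>j. count_list w j = count_list (e # v) j" "l \<le> length v"
         "word_insert v l = (w, e)"
        using 2(1)[OF False lw _ vl] by auto
      have "antimono (count_list u)"
        unfolding antimono_nat_iff
      proof
        fix i
        have "count_list (d # w) (Suc i) \<le> count_list (d # w) i"
          using antimonoD[OF ad, of i "Suc i"] by (simp del: count_list.simps)
        then show "count_list u (Suc i) \<le> count_list u i"
          using IH(2)[of i] IH(2)[of "Suc i"] 2(4) False
          by (auto simp: uk removable_def split: if_splits)
      qed
      then show ?thesis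
        using IH False by (auto simp: uk)
    next
      case True
      show ?thesis
      proof (cases "d \<in> set w")
        case False
        then have uk: "u = w" "k = 0"
          using 2(5) True by auto
        have "(LEAST j. j \<notin> set w) = d"
        proof (rule Least_equality)
          fix y assume "y \<notin> set w"
          then show "d \<le> y"
            using dl by (intro leI) force
        qed (rule False)
        then show ?thesis
          using lw True by (simp add: uk Let_def)
      next
        case dw: True
        define c where "c = (GREATEST j. count_list w j = count_list w d)"
        \<comment> \<open>\<open>GREATEST\<close> needs a bound: the height of column
          \<open>d\<close> is positive, so every column of that height occurs as a letter of
          \<open>w\<close>.\<close>
        obtain b where b: "\<forall>j\<in>set w. j \<le> b"
          using finite_nat_set_iff_bounded_le by blast
        have bd: "y \<le> b" if "count_list w y = count_list w d" for y
          using that dw b count_list_0_iff[of w y] count_list_0_iff[of w d] by simp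
        have c: "count_list w c = count_list w d"
          unfolding c_def by (rule GreatestI_nat[where k = d and b = b]) (use bd in auto)
        have cS: "count_list w (Suc c) < count_list w d"
        proof -
          have "count_list w (Suc c) \<noteq> count_list w d"
            using Greatest_le_nat[of "\<lambda>j. count_list w j = count_list w d" "Suc c" b] bd
            unfolding c_def by auto
          then show ?thesis
            using antimonoD[OF aw, of c "Suc c"] c by simp
        qed
        obtain v l where vl: "word_delete w c = (v, l)" by fastforce
        have uk: "u = c # v" "k = Suc l"
          using 2(5) True dw vl by (auto simp: c_def)
        have rc: "removable w c"
          using c cS by (simp add: removable_def)
        have IH: "ballot v" "\<And>j. count_list w j = count_list (c # v) j" "l \<le> length v"
          "word_insert v l = (w, c)"
          using "2.IH"(2)[OF _ _ c_def lw rc vl] True dw by auto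
        have "(LEAST j. count_list w j = count_list w c) = d"
          using Least_level[OF aw dl] c by simp
        then have "word_insert u k = (d # w, e)"
          using IH(4) True by (simp add: uk)
        moreover have "ballot u"
        proof -
          have "count_list (c # v) = count_list w"
            using IH(2) by presburger
          then show ?thesis
            using IH(1) aw by (simp add: uk del: count_list.simps)
        qed
        moreover have "count_list (d # w) j = count_list (e # u) j" for j
          using IH(2)[of j] True by (simp add: uk)
        ultimately show ?thesis
          using IH(3) by (simp add: uk)
      qed
    qed
  qed
  then show "ballot u" "\<And>j. count_list w j = count_list (e # u) j" "k \<le> length u"
        "word_insert u k = (w, e)" by auto
qed

subsection \<open>Permutations as insertion histories\<close>

definition has_desc_subseq :: "nat \<Rightarrow> nat list \<Rightarrow> bool" where
  "has_desc_subseq q R \<longleftrightarrow> (\<exists>xs. subseq xs R \<and> length xs = q \<and> sorted_wrt (>) xs)"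

text \<open>
  A permutation is encoded by the positions at which its values were inserted in increasing order,
  the last insertion first. Permutations are read from right to left here, to match the words.
\<close>

primrec gaps :: "nat \<Rightarrow> nat list set" where
  "gaps 0 = {[]}"
| "gaps (Suc n) = (\<lambda>(k, ks). k # ks) ` ({..n} \<times> gaps n)"

primrec perm_of :: "nat list \<Rightarrow> nat list" where
  "perm_of [] = []"
| "perm_of (k # ks) = take k (perm_of ks) @ Suc (length ks) # drop k (perm_of ks)"

primrec word_of :: "nat list \<Rightarrow> nat list" where
  "word_of [] = []"
| "word_of (k # ks) = fst (word_insert (word_of ks) k)"

lemma subseq_rev: "subseq xs ys \<Longrightarrow> subseq (rev xs) (rev ys)"
  by (induction rule: list_emb.induct) (auto intro: list_emb_append_mono)

lemma has_ascending_subseq_rev: "has_ascending_subseq q (rev R) \<longleftrightarrow> has_desc_subseq q R"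
proof
  assume "has_ascending_subseq q (rev R)"
  then obtain xs where "subseq xs (rev R)" "length xs = q" "sorted_wrt (<) xs"
    unfolding has_ascending_subseq_def by blast
  then show "has_desc_subseq q R"
    unfolding has_desc_subseq_def using subseq_rev[of xs "rev R"]
    by (intro exI[of _ "rev xs"]) (auto simp: sorted_wrt_rev)
next
  assume "has_desc_subseq q R"
  then obtain xs where "subseq xs R" "length xs = q" "sorted_wrt (>) xs"
    unfolding has_desc_subseq_def by blast
  then show "has_ascending_subseq q (rev R)"
    unfolding has_ascending_subseq_def using subseq_rev[of xs R]
    by (intro exI[of _ "rev xs"]) (auto simp: sorted_wrt_rev)
qed

lemma has_desc_subseq_0 [simp]: "has_desc_subseq 0 R"
  by (auto simp: has_desc_subseq_def)

lemma has_desc_subseq_Suc_Nil [simp]: "\<not> has_desc_subseq (Suc q) []"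
  by (auto simp: has_desc_subseq_def)

text \<open>A maximum can only be the first entry of a descending subsequence, so what follows it
  must be chosen from \<open>B\<close>.\<close>

lemma has_desc_subseq_insert_max:
  assumes "\<forall>x\<in>set A. x < M" "\<forall>x\<in>set B. x < M"
  shows "has_desc_subseq (Suc q) (A @ M # B) \<longleftrightarrow> has_desc_subseq (Suc q) (A @ B) \<or> has_desc_subseq q B"
proof
  assume "has_desc_subseq (Suc q) (A @ M # B)"
  then obtain xs where xs: "subseq xs (A @ M # B)" "length xs = Suc q" "sorted_wrt (>) xs"
    unfolding has_desc_subseq_def by blast
  then obtain xs1 xs2 where x12: "xs = xs1 @ xs2" "subseq xs1 A" "subseq xs2 (M # B)"
    by (auto simp: subseq_append_iff)
  show "has_desc_subseq (Suc q) (A @ B) \<or> has_desc_subseq q B"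
  proof (cases "subseq xs2 B")
    case True
    then have "subseq xs (A @ B)"
      using x12 by (auto intro: list_emb_append_mono)
    then show ?thesis
      using xs by (auto simp: has_desc_subseq_def)
  next
    case False
    then obtain xs3 where x3: "xs2 = M # xs3" "subseq xs3 B"
      using x12(3) by (cases xs2) (auto split: if_splits)
    have "xs1 = []"
    proof (rule ccontr)
      assume "xs1 \<noteq> []"
      then obtain x where x: "x \<in> set xs1"
        by (meson list.set_sel(1))
      then have "x \<in> set A"
        using x12(2) by (auto elim: list_emb_set)
      moreover have "M < x"
        using x xs(3) x12(1) x3(1) by (auto simp: sorted_wrt_append)
      ultimately show False
        using assms(1) by fastforce
    qed
    then show ?thesis
      using x12 x3 xs by (auto simp: has_desc_subseq_def)
  qed
next
  assume "has_desc_subseq (Suc q) (A @ B) \<or> has_desc_subseq q B"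
  then show "has_desc_subseq (Suc q) (A @ M # B)"
  proof
    assume "has_desc_subseq (Suc q) (A @ B)"
    moreover have "subseq (A @ B) (A @ M # B)"
      by (intro list_emb_append_mono) auto
    ultimately show ?thesis
      unfolding has_desc_subseq_def using subseq_order.trans by blast
  next
    assume "has_desc_subseq q B"
    then obtain xs where xs: "subseq xs B" "length xs = q" "sorted_wrt (>) xs"
      unfolding has_desc_subseq_def by blast
    moreover have "\<forall>x\<in>set xs. x < M"
      using assms(2) xs(1) by (auto elim: list_emb_set)
    moreover have "subseq (M # xs) (A @ M # B)"
      using xs(1) by (simp add: list_emb_append2)
    ultimately show ?thesis
      unfolding has_desc_subseq_def by (intro exI[of _ "M # xs"]) auto
  qed
qed

section \<open>Insertion histories in bijection with permutations\<close>

lemma length_gaps: "ks \<in> gaps n \<Longrightarrow> length ks = n"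
  by (induction n arbitrary: ks) auto

lemma finite_gaps [simp]: "finite (gaps n)"
  by (induction n) auto

lemma card_gaps: "card (gaps n) = fact n"
  by (induction n) (auto simp: card_image inj_on_def card_cartesian_product)

lemma perm_of_gaps:
  "ks \<in> gaps n \<Longrightarrow> distinct (perm_of ks) \<and> set (perm_of ks) = {1..n} \<and> length (perm_of ks) = n"
proof (induction n arbitrary: ks)
  case (Suc n)
  then obtain k js where ks: "ks = k # js" "k \<le> n" "js \<in> gaps n"
    by auto
  let ?R = "perm_of js"
  have R: "distinct ?R" "set ?R = {1..n}" "length ?R = n"
    using Suc.IH ks by auto
  have tk: "set (take k ?R) \<union> set (drop k ?R) = {1..n}"
    by (metis R(2) append_take_drop_id set_append)
  have "set (perm_of ks) = insert (Suc n) (set (take k ?R) \<union> set (drop k ?R))"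
    using length_gaps[OF ks(3)] by (simp add: ks)
  then have "set (perm_of ks) = {1..Suc n}"
    unfolding tk by (subst atLeastAtMostSuc_conv) simp_all
  moreover have "length (perm_of ks) = Suc n"
    using R ks by simp
  ultimately show ?case
    by (simp add: card_distinct)
qed simp

text \<open>The place of the maximum \<open>Suc n\<close> reveals the last gap, and deleting it
  leaves the permutation of the shorter history.\<close>

lemma inj_on_perm_of: "inj_on perm_of (gaps n)"
proof (induction n)
  case (Suc n)
  show ?case
  proof (rule inj_onI)
    fix ks ks' assume "ks \<in> gaps (Suc n)" "ks' \<in> gaps (Suc n)" and eq: "perm_of ks = perm_of ks'"
    then obtain k js k' js' where ks: "ks = k # js" "k \<le> n" "js \<in> gaps n"
      and ks': "ks' = k' # js'" "k' \<le> n" "js' \<in> gaps n"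
      by auto
    let ?R = "perm_of js" and ?R' = "perm_of js'"
    have R: "set ?R = {1..n}" "length ?R = n" "set ?R' = {1..n}" "length ?R' = n"
      using perm_of_gaps ks ks' by auto
    have *: "Suc n \<notin> set (take k ?R)" "Suc n \<notin> set (drop k ?R)"
      using R by (auto dest: in_set_takeD in_set_dropD)
    have "take k ?R = take k' ?R' \<and> drop k ?R = drop k' ?R'"
      using eq append_Cons_eq_iff[OF *] length_gaps ks ks' by simp
    moreover from this have "k = k'"
      using R ks(2) ks'(2) by (metis length_take min.absorb2)
    ultimately have "k = k'" "?R = ?R'"
      by (metis append_take_drop_id)+
    then show "ks = ks'"
      using Suc ks ks' by (auto dest: inj_onD)
  qed
qed simp

text \<open>Surjectivity follows by counting, as both sets have \<open>fact n\<close>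
  elements.\<close>

lemma bij_betw_perm_of: "bij_betw perm_of (gaps n) (permutations_of_set {1..n})"
  unfolding bij_betw_def
proof
  have "perm_of ` gaps n \<subseteq> permutations_of_set {1..n}"
    using perm_of_gaps by (auto simp: permutations_of_set_def)
  then show "perm_of ` gaps n = permutations_of_set {1..n}"
    by (intro card_subset_eq) (auto simp: card_image inj_on_perm_of card_gaps)
qed (rule inj_on_perm_of)

section \<open>Letters of the word and descending subsequences, suffix by suffix\<close>

lemma word_of_gaps: "ks \<in> gaps n \<Longrightarrow> ballot (word_of ks) \<and> length (word_of ks) = n"
proof (induction n arbitrary: ks)
  case (Suc n)
  then obtain k js where ks: "ks = k # js" "k \<le> n" "js \<in> gaps n"
    by auto
  then show ?case
    using Suc.IH[OF ks(3)] word_insert_correct(1,3)[of "word_of js" k, OF _ _ prod.collapse[symmetric]]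
    by simp
qed simp

text \<open>The recursion treats the tail first, so a suffix of the result depends only on the same
  suffix of the input. With \<open>drop_Suc_word_insert\<close>, which covers the suffixes untouched
  by the insertion, this allows an induction over all suffixes at once.\<close>

lemma drop_word_insert:
  "i \<le> k \<Longrightarrow> k \<le> length u \<Longrightarrow> drop i (fst (word_insert u k)) = fst (word_insert (drop i u) (k - i))"
proof (induction u k arbitrary: i rule: word_insert.induct)
  case (2 c u k)
  obtain w e where "word_insert u k = (w, e)" by fastforce
  then show ?case
    using 2 by (cases i) (auto simp: Let_def)
qed auto

lemma drop_Suc_word_insert: "k \<le> i \<Longrightarrow> k \<le> length u \<Longrightarrow> drop (Suc i) (fst (word_insert u k)) = drop i u"
proof (induction u k arbitrary: i rule: word_insert.induct)
  case (2 c u k)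
  obtain w e where "word_insert u k = (w, e)" by fastforce
  then show ?case
    using 2 by (cases i) (auto simp: Let_def)
qed (auto simp: Let_def)

text \<open>Only the starting box can bring a new letter: a bumped box goes to a column of the same
  positive height as \<open>e\<close>, hence to a letter already present in
  \<open>w\<close>.\<close>

lemma set_word_insert:
  "ballot u \<Longrightarrow> k \<le> length u \<Longrightarrow> set (fst (word_insert u k)) = insert (LEAST j. j \<notin> set (drop k u)) (set u)"
proof (induction u k rule: word_insert.induct)
  case (2 c u k)
  obtain w e where we: "word_insert u k = (w, e)" by fastforce
  note ic = word_insert_correct[OF _ _ we]
  have sw: "set w = insert (LEAST j. j \<notin> set (drop k u)) (set u)"
    using 2 we by auto
  show ?case
  proof (cases "c = e")
    case True
    define d where "d = (LEAST j. count_list w j = count_list w e)"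
    have d: "count_list w d = count_list w e"
      unfolding d_def by (rule LeastI[of _ e]) simp
    have e: "e \<in> set w"
      using ic(4) 2 by (intro removable_in_set) auto
    then have "d \<in> set w"
      using d count_list_0_iff[of w d] count_list_0_iff[of w e] by auto
    moreover have "fst (word_insert (c # u) (Suc k)) = d # w"
      using True we by (simp add: d_def Let_def)
    ultimately show ?thesis
      using sw e True by auto
  next
    case False
    then show ?thesis
      using sw we by auto
  qed
qed (auto simp: Let_def)

lemma ballot_down_closed:
  assumes "ballot u" "j \<in> set u" "i \<le> j"
  shows "i \<in> set u"
  using antimonoD[OF ballot_antimono[OF assms(1)] assms(3)] assms(2) count_list_0_iff[of u i]
    count_list_0_iff[of u j] by auto

text \<open>Schensted's theorem for all suffixes simultaneously. Inserting a maximum at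
  \<open>k\<close> changes both sides alike; the effect is governed by the suffix from
  \<open>k\<close> on, which is why \<open>i\<close> is kept arbitrary in the induction.\<close>

lemma has_desc_subseq_iff_letter:
  "ks \<in> gaps n \<Longrightarrow> has_desc_subseq (Suc q) (drop i (perm_of ks)) \<longleftrightarrow> q \<in> set (drop i (word_of ks))"
proof (induction n arbitrary: ks i q)
  case (Suc n)
  then obtain k js where ks: "ks = k # js" "k \<le> n" "js \<in> gaps n"
    by auto
  let ?R = "perm_of js" and ?u = "word_of js"
  have R: "set ?R = {1..n}" "length ?R = n"
    using perm_of_gaps ks by auto
  have u: "ballot ?u" "length ?u = n"
    using word_of_gaps ks by auto
  have n: "length js = n"
    using length_gaps ks by simp
  show ?case
  proof (cases "i \<le> k")
    case True
    let ?B = "drop k ?u"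
    \<comment> \<open>The letters of a ballot word form an initial segment, so by the induction
      hypothesis the least missing letter is the length of a longest descending subsequence of
      \<open>drop k ?R\<close>.\<close>
    have mex: "has_desc_subseq q (drop k ?R) \<longleftrightarrow> q \<le> (LEAST j. j \<notin> set ?B)"
    proof (cases q)
      case (Suc q')
      have "q' \<in> set ?B \<longleftrightarrow> q' < (LEAST j. j \<notin> set ?B)"
      proof
        assume "q' \<in> set ?B"
        moreover have "(LEAST j. j \<notin> set ?B) \<notin> set ?B"
          by (rule LeastI_ex) (rule ex_not_in_list)
        ultimately show "q' < (LEAST j. j \<notin> set ?B)"
          using ballot_down_closed[OF ballot_drop[OF u(1)]] by (meson leI)
      next
        assume "q' < (LEAST j. j \<notin> set ?B)"
        then show "q' \<in> set ?B"
          using not_less_Least by blast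
      qed
      then show ?thesis
        using Suc.IH[OF ks(3)] Suc by auto
    qed simp
    have less: "j \<in> set (drop i ?u)" if "j < (LEAST j. j \<notin> set ?B)" for j
      using not_less_Least[OF that] set_drop_subset_set_drop[OF True, of ?u] by auto
    have "drop i (perm_of ks) = take (k - i) (drop i ?R) @ Suc n # drop (k - i) (drop i ?R)"
      using True ks R n by (simp add: drop_take)
    moreover have "x < Suc n" if "x \<in> set ?R" for x
      using that R(1) by simp
    then have "\<forall>x\<in>set (take (k - i) (drop i ?R)). x < Suc n"
      "\<forall>x\<in>set (drop (k - i) (drop i ?R)). x < Suc n"
      by (meson in_set_takeD in_set_dropD)+
    ultimately have "has_desc_subseq (Suc q) (drop i (perm_of ks)) \<longleftrightarrow>
        has_desc_subseq (Suc q) (drop i ?R) \<or> has_desc_subseq q (drop (k - i) (drop i ?R))"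
      by (simp only: has_desc_subseq_insert_max append_take_drop_id)
    moreover have "drop (k - i) (drop i ?R) = drop k ?R"
      using True by simp
    ultimately have "has_desc_subseq (Suc q) (drop i (perm_of ks)) \<longleftrightarrow>
        has_desc_subseq (Suc q) (drop i ?R) \<or> has_desc_subseq q (drop k ?R)"
      by simp
    also have "\<dots> \<longleftrightarrow> q \<in> set (drop i ?u) \<or> q \<le> (LEAST j. j \<notin> set ?B)"
      using mex Suc.IH[OF ks(3)] by simp
    also have "\<dots> \<longleftrightarrow> q \<in> insert (LEAST j. j \<notin> set ?B) (set (drop i ?u))"
      using less[of q] by (auto simp: le_less)
    also have "\<dots> \<longleftrightarrow> q \<in> set (drop i (word_of ks))"
      using True ks u set_word_insert[OF ballot_drop[OF u(1)], of "k - i" i] by (simp add: drop_word_insert)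
    finally show ?thesis .
  next
    case False
    \<comment> \<open>The suffix begins to the right of the new maximum, so on both sides it is an
      old suffix with index one smaller.\<close>
    then obtain i' where i': "i = Suc i'" "k \<le> i'"
      by (cases i) auto
    have "drop i (perm_of ks) = drop i' ?R"
      using i' ks R by (simp add: Suc_diff_le)
    moreover have "drop i (word_of ks) = drop i' ?u"
      using i' ks u by (simp add: drop_Suc_word_insert)
    ultimately show ?thesis
      using Suc.IH[OF ks(3)] by simp
  qed
qed simp

text \<open>A history with word \<open>w\<close> splits into its last gap and a shorter history. By
  the inverse pair of insertion and deletion, the column \<open>e\<close> of the extra box
  determines the gap and the word of the shorter history.\<close>

lemma card_word_of_rec:
  assumes "ballot w" "length w = Suc n"
  shows "card {ks \<in> gaps (Suc n). word_of ks = w} =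
    (\<Sum>e | removable w e. card {ks \<in> gaps n. word_of ks = fst (word_delete w e)})"
proof -
  have fin: "finite {e. removable w e}"
    by (rule finite_subset[of _ "set w"]) (auto intro: removable_in_set)
  let ?S = "\<lambda>e. {ks \<in> gaps n. word_of ks = fst (word_delete w e)}"
  let ?f = "\<lambda>(e, ks). snd (word_delete w e) # ks"
  have "bij_betw ?f (SIGMA e:{e. removable w e}. ?S e) {ks \<in> gaps (Suc n). word_of ks = w}"
    unfolding bij_betw_def
  proof
    have dw: "length (fst (word_delete w e)) = n" "snd (word_delete w e) \<le> n"
      "word_insert (fst (word_delete w e)) (snd (word_delete w e)) = (w, e)" if "removable w e" for e
    proof -
      note dc = word_delete_correct[OF assms(1) that, of "fst (word_delete w e)" "snd (word_delete w e)"]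
      show i: "word_insert (fst (word_delete w e)) (snd (word_delete w e)) = (w, e)"
        using dc by simp
      then show "length (fst (word_delete w e)) = n"
        using word_insert_correct(3)[OF dc(1) dc(3) i] assms(2) by simp
      then show "snd (word_delete w e) \<le> n"
        using dc(3) by simp
    qed
    show "inj_on ?f (SIGMA e:{e. removable w e}. ?S e)"
      using dw(3) by (auto simp: inj_on_def) (metis prod.inject)
    show "?f ` (SIGMA e:{e. removable w e}. ?S e) = {ks \<in> gaps (Suc n). word_of ks = w}"
    proof (intro equalityI subsetI)
      fix ks assume "ks \<in> ?f ` (SIGMA e:{e. removable w e}. ?S e)"
      then show "ks \<in> {ks \<in> gaps (Suc n). word_of ks = w}"
        using dw by force
    next
      fix ks assume "ks \<in> {ks \<in> gaps (Suc n). word_of ks = w}"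
      then obtain k js where ks: "ks = k # js" "k \<le> n" "js \<in> gaps n" "word_of (k # js) = w"
        by auto
      define e where "e = snd (word_insert (word_of js) k)"
      have "word_insert (word_of js) k = (w, e)"
        using ks(4) by (simp add: e_def prod_eq_iff)
      then have "removable w e" "word_delete w e = (word_of js, k)"
        using word_insert_correct[of "word_of js" k w e] word_of_gaps[OF ks(3)] ks(2) by auto
      then show "ks \<in> ?f ` (SIGMA e:{e. removable w e}. ?S e)"
        using ks by (intro image_eqI[of _ _ "(e, js)"]) auto
    qed
  qed
  then show ?thesis
    using bij_betw_same_card fin by (subst card_SigmaI[symmetric]) (auto dest: bij_betw_same_card)
qed

subsection \<open>Determinants of inverse factorials\<close>

text \<open>The value 0 at negative arguments makes \<open>z * (1/z!) = 1/(z-1)!\<close> hold for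
  every integer \<open>z\<close>, including 0.\<close>

definition inv_fact :: "int \<Rightarrow> rat" where
  "inv_fact z = (if z < 0 then 0 else 1 / fact (nat z))"

lemma inv_fact_rec: "of_int z * inv_fact z = inv_fact (z - 1)"
proof (cases "z \<le> 0")
  case False
  then obtain n where "z = int (Suc n)"
    by (metis gr0_implies_Suc linorder_not_le zero_less_imp_eq_int)
  then show ?thesis
    by (simp add: inv_fact_def nat_add_distrib)
qed (auto simp: inv_fact_def)

text \<open>For a ballot word \<open>w\<close> with letters below \<open>m\<close> and
  \<open>b = coords w\<close>, this is Aitken's determinant: the number of standard Young tableaux
  of the shape of \<open>w\<close>, divided by \<open>fact (length w)\<close>.\<close>

definition fact_det :: "nat \<Rightarrow> (nat \<Rightarrow> int) \<Rightarrow> rat" where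
  "fact_det m b = det (mat m m (\<lambda>(i, j). inv_fact (b i + int j)))"

text \<open>
  In the shifted coordinates, a move within the set of partitions is blocked exactly if two coordinates
  become equal, where alternating functions vanish.
\<close>

definition coords :: "nat list \<Rightarrow> nat \<Rightarrow> int" where
  "coords w i = int (count_list w i) - int i"

definition antisym_fun :: "nat \<Rightarrow> ((nat \<Rightarrow> int) \<Rightarrow> rat) \<Rightarrow> bool" where
  "antisym_fun m G \<longleftrightarrow>
     (\<forall>b i j. i < m \<longrightarrow> j < m \<longrightarrow> i \<noteq> j \<longrightarrow> G (b \<circ> transpose i j) = - G b)"

definition up_sum :: "nat \<Rightarrow> ((nat \<Rightarrow> int) \<Rightarrow> rat) \<Rightarrow> (nat \<Rightarrow> int) \<Rightarrow> rat" where
  "up_sum m G b = (\<Sum>c<m. G (b(c := b c + 1)))"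

lemma fact_det_Leibniz:
  "fact_det m b = (\<Sum>p | p permutes {0..<m}. signof p * (\<Prod>i<m. inv_fact (b i + int (p i))))"
  unfolding fact_det_def
  by (subst det_def', rule mat_carrier, rule sum.cong[OF refl])
     (auto simp: atLeast0LessThan permutes_in_image intro!: prod.cong)

lemma antisym_fact_det: "antisym_fun m (fact_det m)"
  unfolding antisym_fun_def
proof (intro allI impI)
  fix b :: "nat \<Rightarrow> int" and i j assume ij: "i < m" "j < m" "i \<noteq> j"
  let ?A = "mat m m (\<lambda>(i, j). inv_fact (b i + int j))"
  have p: "transpose i j permutes {0..<m}"
    using ij by (intro permutes_swap_id) auto
  have "fact_det m (b \<circ> transpose i j) = det (mat m m (\<lambda>(r, s). ?A $$ (transpose i j r, s)))"
    unfolding fact_det_def using permutes_in_image[OF p]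
    by (intro arg_cong[of _ _ det] eq_matI) auto
  also have "\<dots> = signof (transpose i j) * det ?A"
    by (rule det_permute_rows[OF _ p]) simp
  finally show "fact_det m (b \<circ> transpose i j) = - fact_det m b"
    using ij by (simp add: fact_det_def sign_swap_id)
qed

lemma antisym_fun_zero:
  assumes "antisym_fun m G" "i < m" "j < m" "i \<noteq> j" "b i = b j"
  shows "G b = 0"
proof -
  have "b \<circ> transpose i j = b"
    using assms(5) by (auto simp: transpose_def)
  then have "G b = - G b"
    using assms unfolding antisym_fun_def by metis
  then show ?thesis by simp
qed

text \<open>Swapping two coordinates only permutes the possible unit steps. This keeps the function
  alternating when the most recent letter of a word is absorbed into it.\<close>

lemma antisym_up_sum:
  assumes "antisym_fun m G"
  shows "antisym_fun m (up_sum m G)"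
  unfolding antisym_fun_def
proof (intro allI impI)
  fix b :: "nat \<Rightarrow> int" and i j assume ij: "i < m" "j < m" "i \<noteq> j"
  let ?t = "transpose i j" and ?f = "\<lambda>c. - G (b(c := b c + 1))"
  have "(b \<circ> ?t)(c := (b \<circ> ?t) c + 1) = b(?t c := b (?t c) + 1) \<circ> ?t" for c
    by (auto simp: fun_eq_iff transpose_def)
  then have "up_sum m G (b \<circ> ?t) = (\<Sum>c<m. ?f (?t c))"
    using assms ij by (simp add: up_sum_def antisym_fun_def)
  also have "\<dots> = (\<Sum>c<m. ?f c)"
    by (rule sum.permute[OF permutes_swap_id, symmetric, unfolded o_def]) (use ij in auto)
  finally show "up_sum m G (b \<circ> ?t) = - up_sum m G b"
    by (simp add: up_sum_def sum_negf)
qed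

text \<open>In the Leibniz term of \<open>p\<close>, lowering \<open>b i\<close> multiplies by
  \<open>b i + p i\<close>. Summed over \<open>i\<close>, these factors no longer depend on
  \<open>p\<close>.\<close>

lemma fact_det_down_sum:
  "(\<Sum>i<m. fact_det m (b(i := b i - 1))) = of_int (\<Sum>i<m. b i + int i) * fact_det m b"
proof -
  have *: "(\<Sum>i<m. \<Prod>k<m. inv_fact ((b(i := b i - 1)) k + int (p k))) =
      of_int (\<Sum>i<m. b i + int i) * (\<Prod>k<m. inv_fact (b k + int (p k)))"
    if p: "p permutes {0..<m}" for p
  proof -
    have "(\<Prod>k<m. inv_fact ((b(i := b i - 1)) k + int (p k))) =
       of_int (b i + int (p i)) * (\<Prod>k<m. inv_fact (b k + int (p k)))" if "i < m" for i
    proof -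
      have "(\<Prod>k<m. inv_fact ((b(i := b i - 1)) k + int (p k))) =
        inv_fact (b i - 1 + int (p i)) * (\<Prod>k\<in>{..<m} - {i}. inv_fact (b k + int (p k)))"
        using that by (subst prod.remove[of _ i]) auto
      also have "inv_fact (b i - 1 + int (p i)) = of_int (b i + int (p i)) * inv_fact (b i + int (p i))"
        by (subst inv_fact_rec) (simp add: algebra_simps)
      finally show ?thesis
        using that by (simp add: prod.remove[of "{..<m}" i])
    qed
    then have "(\<Sum>i<m. \<Prod>k<m. inv_fact ((b(i := b i - 1)) k + int (p k))) =
      of_int (\<Sum>i<m. b i + int (p i)) * (\<Prod>k<m. inv_fact (b k + int (p k)))"
      by (simp add: sum_distrib_right)
    also have "(\<Sum>i<m. b i + int (p i)) = (\<Sum>i<m. b i + int i)"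
      using sum.permute[OF p, of int] by (simp add: sum.distrib atLeast0LessThan o_def)
    finally show ?thesis .
  qed
  have "(\<Sum>i<m. fact_det m (b(i := b i - 1))) =
    (\<Sum>p | p permutes {0..<m}. signof p *
       (\<Sum>i<m. \<Prod>k<m. inv_fact ((b(i := b i - 1)) k + int (p k))))"
    unfolding fact_det_Leibniz sum_distrib_left by (rule sum.swap)
  also have "\<dots> = (\<Sum>p | p permutes {0..<m}. signof p *
       (of_int (\<Sum>i<m. b i + int i) * (\<Prod>k<m. inv_fact (b k + int (p k)))))"
    using * by (intro sum.cong refl) auto
  also have "\<dots> = of_int (\<Sum>i<m. b i + int i) * fact_det m b"
    by (simp add: fact_det_Leibniz sum_distrib_left algebra_simps del: of_int_sum)
  finally show ?thesis .
qed

text \<open>The entries \<open>1/(j - i)!\<close> form a unitriangular matrix. This is the case of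
  the empty shape.\<close>

lemma fact_det_origin: "fact_det m (\<lambda>i. - int i) = 1"
proof -
  let ?A = "mat m m (\<lambda>(i, j). inv_fact (- int i + int j))"
  have "upper_triangular ?A"
    by (auto simp: inv_fact_def)
  then have "det ?A = prod_list (diag_mat ?A)"
    by (rule det_upper_triangular) (rule mat_carrier)
  also have "\<dots> = 1"
  proof -
    have "diag_mat ?A = replicate m 1"
      by (rule nth_equalityI) (auto simp: diag_mat_def inv_fact_def)
    then show ?thesis
      by simp
  qed
  finally show ?thesis
    by (simp add: fact_det_def)
qed

lemma fact_det_zero_row:
  assumes "i < m" "b i + int m \<le> 0"
  shows "fact_det m b = 0"
  unfolding fact_det_Leibniz
proof (intro sum.neutral ballI)
  fix p assume "p \<in> {p. p permutes {0..<m}}"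
  then have "p i < m"
    using assms(1) permutes_in_image[of p "{0..<m}" i] by simp
  then have "inv_fact (b i + int (p i)) = 0"
    using assms(2) by (simp add: inv_fact_def)
  then have "(\<Prod>k<m. inv_fact (b k + int (p k))) = 0"
    using assms(1) by (intro prod_zero) auto
  then show "signof p * (\<Prod>k<m. inv_fact (b k + int (p k))) = 0"
    by simp
qed

section \<open>Exponential generating functions over words and coefficients of the
  \<open>I\<close>-series\<close>

lemma fps_deriv_prod:
  fixes f :: "'a \<Rightarrow> 'b::comm_ring_1 fps"
  shows "finite A \<Longrightarrow> fps_deriv (prod f A) = (\<Sum>a\<in>A. fps_deriv (f a) * prod f (A - {a}))"
proof (induction A rule: finite_induct)
  case (insert x A)
  have "prod f (insert x A - {a}) = f x * prod f (A - {a})" if "a \<in> A" for a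
    using insert that by (subst insert_Diff_if) (auto simp: prod.insert)
  moreover have "insert x A - {x} = A"
    using insert by auto
  ultimately show ?case
    using insert by (simp add: sum_distrib_left mult.left_commute cong: sum.cong)
qed simp

lemma sum_lists_Suc:
  fixes f :: "nat list \<Rightarrow> 'a::comm_monoid_add"
  shows "(\<Sum>w | set w \<subseteq> {..<m} \<and> length w = Suc n. f w) =
    (\<Sum>w | set w \<subseteq> {..<m} \<and> length w = n. \<Sum>c<m. f (c # w))"
proof -
  have "(\<Sum>w | set w \<subseteq> {..<m} \<and> length w = Suc n. f w) =
    (\<Sum>(c, w)\<in>{..<m} \<times> {w. set w \<subseteq> {..<m} \<and> length w = n}. f (c # w))"
    by (rule sum.reindex_bij_witness[of _ "\<lambda>(c, w). c # w" "\<lambda>w. (hd w, tl w)"])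
       (auto simp: length_Suc_conv)
  also have "\<dots> = (\<Sum>w | set w \<subseteq> {..<m} \<and> length w = n. \<Sum>c<m. f (c # w))"
    by (subst sum.cartesian_product[symmetric]) (rule sum.swap)
  finally show ?thesis .
qed

text \<open>Splitting off a letter \<open>c\<close> shifts the sequence \<open>a c\<close>, which
  differentiates the factor of \<open>c\<close>. Summing over \<open>c\<close> gives the product
  rule, so the induction on \<open>n\<close> reads off successive derivatives of the
  product.\<close>

lemma sum_words_egf:
  fixes a :: "nat \<Rightarrow> nat \<Rightarrow> rat"
  shows "(\<Sum>w | set w \<subseteq> {..<m} \<and> length w = n. \<Prod>i<m. a i (count_list w i)) =
    fact n * fps_nth (\<Prod>i<m. Abs_fps (\<lambda>k. a i k / fact k)) n"
proof (induction n arbitrary: a)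
  case 0
  have "{w. set w \<subseteq> {..<m} \<and> length w = 0} = {[]}"
    by auto
  moreover have "fps_nth (\<Prod>i\<in>S. Abs_fps (\<lambda>k. a i k / fact k)) 0 = (\<Prod>i\<in>S. a i 0)"
    if "finite S" for S
    using that by (induction S) auto
  ultimately show ?case
    by simp
next
  case (Suc n)
  define F where "F a = Abs_fps (\<lambda>k. a k / fact k)" for a :: "nat \<Rightarrow> rat"
  have deriv: "fps_deriv (F a) = F (\<lambda>k. a (Suc k))" for a
  proof (rule fps_ext)
    fix n
    have "(1 + of_nat n) * a (Suc n) / ((1 + of_nat n) * fact n) = a (Suc n) / fact n"
      by (rule nonzero_mult_divide_mult_cancel_left) (metis of_nat_Suc of_nat_neq_0)
    then show "fps_nth (fps_deriv (F a)) n = fps_nth (F (\<lambda>k. a (Suc k))) n"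
      by (simp add: F_def del: nonzero_mult_divide_mult_cancel_left)
  qed
  let ?a = "\<lambda>c. a(c := \<lambda>k. a c (Suc k))"
  have "(\<Prod>i<m. a i (count_list (c # w) i)) = (\<Prod>i<m. ?a c i (count_list w i))" for c w
    by (intro prod.cong) auto
  then have "(\<Sum>w | set w \<subseteq> {..<m} \<and> length w = Suc n. \<Prod>i<m. a i (count_list w i)) =
    (\<Sum>c<m. \<Sum>w | set w \<subseteq> {..<m} \<and> length w = n. \<Prod>i<m. ?a c i (count_list w i))"
    by (subst sum_lists_Suc) (simp add: sum.swap[of _ "{..<m}"])
  also have "\<dots> = (\<Sum>c<m. fact n * fps_nth (\<Prod>i<m. F (?a c i)) n)"
    unfolding Suc.IH F_def ..
  also have "\<dots> = fact n * fps_nth (\<Sum>c<m. \<Prod>i<m. F (?a c i)) n"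
    by (simp add: sum_distrib_left fps_sum_nth)
  also have "(\<Sum>c<m. \<Prod>i<m. F (?a c i)) = (\<Sum>c<m. fps_deriv (F (a c)) * (\<Prod>i\<in>{..<m} - {c}. F (a i)))"
  proof (intro sum.cong refl)
    fix c assume "c \<in> {..<m}"
    then show "(\<Prod>i<m. F (?a c i)) = fps_deriv (F (a c)) * (\<Prod>i\<in>{..<m} - {c}. F (a i))"
      by (subst prod.remove[of _ c]) (auto simp: deriv)
  qed
  also have "\<dots> = fps_deriv (\<Prod>i<m. F (a i))"
    by (rule fps_deriv_prod[symmetric]) simp
  also have "fact n * fps_nth (fps_deriv (\<Prod>i<m. F (a i))) n =
      fact (Suc n) * fps_nth (\<Prod>i<m. F (a i)) (Suc n)"
    by (simp add: algebra_simps)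
  finally show ?case
    unfolding F_def .
qed

lemma I_series_nth:
  "fps_nth (I_series z) N =
     (if int N \<ge> z \<and> even (int N - z)
      then inv_fact ((int N - z) div 2 + z) / fact (nat ((int N - z) div 2)) else 0)"
proof -
  let ?A = "{n::nat. int n \<ge> max 0 (- z)}"
  let ?f = "\<lambda>n. fps_const (1 / (fact n * fact (nat (int n + z))) :: rat) * fps_X ^ nat (2 * int n + z)"
  have "(?f has_sum Abs_fps (\<lambda>k. \<Sum>n | n \<in> ?A \<and> fps_nth (?f n) k \<noteq> 0. fps_nth (?f n) k)) ?A"
  proof (rule has_sum_fps)
    show "finite {n \<in> ?A. fps_nth (?f n) k \<noteq> 0}" for k
      by (rule finite_subset[of _ "{..k + nat \<bar>z\<bar>}"]) (auto split: if_splits)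
  qed
  then have "I_series z = Abs_fps (\<lambda>k. \<Sum>n | n \<in> ?A \<and> fps_nth (?f n) k \<noteq> 0. fps_nth (?f n) k)"
    unfolding I_series_def by (rule infsumI)
  then have I: "fps_nth (I_series z) N = (\<Sum>n | n \<in> ?A \<and> fps_nth (?f n) N \<noteq> 0. fps_nth (?f n) N)"
    by simp
  have f: "fps_nth (?f n) N = (if 2 * int n + z = int N then 1 / (fact n * fact (nat (int n + z))) else 0)"
    if "n \<in> ?A" for n
    using that by auto
  show ?thesis
  proof (cases "\<exists>n\<in>?A. 2 * int n + z = int N")
    case True
    then obtain n where n: "n \<in> ?A" "2 * int n + z = int N"
      by auto
    have "{n. n \<in> ?A \<and> fps_nth (?f n) N \<noteq> 0} = {n}"
      using n f by (auto split: if_splits)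
    moreover have "int N - z = 2 * int n"
      using n by simp
    then have "int N \<ge> z" "even (int N - z)" "(int N - z) div 2 = int n"
      by simp_all
    ultimately show ?thesis
      unfolding I using n f[OF n(1)] by (simp add: inv_fact_def)
  next
    case False
    have e: "{n. n \<in> ?A \<and> fps_nth (?f n) N \<noteq> 0} = {}"
      using False f by auto
    \<comment> \<open>The index \<open>nat d\<close> can miss the summation range only by
      \<open>d < -z\<close>, and then \<open>inv_fact\<close> vanishes. The lower summation bound is
      thus built into \<open>inv_fact\<close>.\<close>
    have "inv_fact ((int N - z) div 2 + z) = 0" if "int N \<ge> z" "even (int N - z)"
    proof -
      define d where "d = (int N - z) div 2"
      have d: "2 * d = int N - z" "d \<ge> 0"
        using that by (simp_all add: d_def)
      then have "2 * int (nat d) + z = int N"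
        by simp
      then have "nat d \<notin> ?A"
        using False by blast
      then show ?thesis
        using d(2) by (simp add: inv_fact_def d_def)
    qed
    then show ?thesis
      unfolding I e by auto
  qed
qed

text \<open>
  The factor \<open>fps_X ^ m\<close> clears the negative powers of \<open>t\<close> that would occur in
  \<open>t\<^sup>z * A(t\<^sup>2)\<close>.
\<close>

lemma I_series_shift:
  assumes "int m + z \<ge> 0"
  shows "fps_X ^ m * I_series z =
    fps_X ^ nat (int m + z) * (Abs_fps (\<lambda>k. inv_fact (int k + z) / fact k) oo fps_X ^ 2)"
proof (rule fps_ext)
  fix N
  show "fps_nth (fps_X ^ m * I_series z) N = fps_nth (fps_X ^ nat (int m + z) *
    (Abs_fps (\<lambda>k. inv_fact (int k + z) / fact k) oo fps_X ^ 2)) N"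
  proof (cases "int N < int m + z")
    case True
    then have "N < nat (int m + z)"
      by linarith
    moreover have "fps_nth (fps_X ^ m * I_series z) N = 0"
    proof (cases "N < m")
      case False
      then have "\<not> int (N - m) \<ge> z"
        using True by linarith
      then show ?thesis
        unfolding fps_X_power_mult_nth I_series_nth using False by (simp only: if_False simp_thms)
    qed (simp add: fps_X_power_mult_nth)
    ultimately show ?thesis
      by (simp add: fps_X_power_mult_nth)
  next
    case False
    define r where "r = N - nat (int m + z)"
    have r: "int N = int r + int m + z"
      using False assms by (simp add: r_def)
    have "fps_nth (fps_X ^ m * I_series z) N =
      (if even r then inv_fact (int (r div 2) + z) / fact (r div 2) else 0)"
    proof (cases "N < m")
      case True
      \<comment> \<open>Here \<open>r + z < 0\<close>, hence also \<open>r div 2 + z < 0\<close>: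
        the right side has no terms below degree \<open>m\<close> either.\<close>
      have "inv_fact (int (r div 2) + z) = 0" if "even r"
        using r True that by (auto simp: inv_fact_def elim!: evenE)
      then show ?thesis
        using True by (simp add: fps_X_power_mult_nth)
    next
      case False
      then have "int (N - m) - z = int r"
        using r by simp
      then show ?thesis
        using False by (simp add: fps_X_power_mult_nth I_series_nth nat_div_distrib zdiv_int)
    qed
    moreover have "\<not> N < nat (int m + z)"
      using False by linarith
    ultimately show ?thesis
      by (simp add: fps_X_power_mult_nth fps_nth_compose_X_power r_def)
  qed
qed

text \<open>In each Leibniz term the offsets \<open>p i - i\<close> sum to 0, so the powers of
  \<open>t\<close> outside the series in \<open>t\<close> squared cancel and only even exponents
  remain.\<close>

lemma det_I_series_nth:
  "fps_nth (det (mat m m (\<lambda>(i, j). I_series (int i - int j)))) N =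
    (if even N then \<Sum>p | p permutes {0..<m}. signof p *
       fps_nth (\<Prod>i<m. Abs_fps (\<lambda>k. inv_fact (int k + (int (p i) - int i)) / fact k)) (N div 2)
     else 0)"
proof -
  let ?A = "\<lambda>p i. Abs_fps (\<lambda>k. inv_fact (int k + (int (p i) - int i)) / fact k)"
  have prod: "(\<Prod>i<m. I_series (int (p i) - int i)) = (\<Prod>i<m. ?A p i) oo fps_X ^ 2"
    if p: "p permutes {0..<m}" for p
  proof -
    \<comment> \<open>Both sides of the product identity carry the same clearing factor
      \<open>fps_X ^ (m * m)\<close>, which is cancelled at the end.\<close>
    have "(\<Sum>i<m. int m + (int (p i) - int i)) = int m * int m"
      using sum.permute[OF p, of int] by (simp add: sum.distrib sum_subtractf atLeast0LessThan o_def)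
    moreover have "(\<Sum>i<m. int m + (int (p i) - int i)) = int (\<Sum>i<m. nat (int m + (int (p i) - int i)))"
      by (simp add: of_nat_sum)
    ultimately have s: "(\<Sum>i<m. nat (int m + (int (p i) - int i))) = m * m"
      by (metis of_nat_eq_iff of_nat_mult)
    have "fps_X ^ (m * m) * (\<Prod>i<m. I_series (int (p i) - int i)) =
      (\<Prod>i<m. fps_X ^ m * I_series (int (p i) - int i))"
      by (simp add: prod.distrib power_mult)
    also have "\<dots> = (\<Prod>i<m. fps_X ^ nat (int m + (int (p i) - int i)) * (?A p i oo fps_X ^ 2))"
      by (intro prod.cong refl I_series_shift) auto
    also have "\<dots> = fps_X ^ (m * m) * (\<Prod>i<m. ?A p i oo fps_X ^ 2)"
      by (simp add: prod.distrib power_sum[symmetric] s)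
    finally show ?thesis
      by (simp add: fps_compose_prod_distrib)
  qed
  \<comment> \<open>Transposing turns the offsets \<open>i - p i\<close> of the Leibniz expansion
    into \<open>p i - i\<close>, as they occur in \<open>fact_det\<close>.\<close>
  have "det (mat m m (\<lambda>(i, j). I_series (int i - int j))) =
    det (transpose_mat (mat m m (\<lambda>(i, j). I_series (int i - int j))))"
    by (rule det_transpose[symmetric]) (rule mat_carrier)
  also have "\<dots> = (\<Sum>p | p permutes {0..<m}. signof p * (\<Prod>i<m. I_series (int (p i) - int i)))"
    by (subst det_def'[of _ m], simp, rule sum.cong[OF refl])
       (auto simp: atLeast0LessThan permutes_in_image intro!: prod.cong)
  also have "\<dots> = (\<Sum>p | p permutes {0..<m}. signof p * ((\<Prod>i<m. ?A p i) oo fps_X ^ 2))"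
    by (intro sum.cong refl) (simp add: prod)
  finally have D: "det (mat m m (\<lambda>(i, j). I_series (int i - int j))) = \<dots>" .
  have sg: "fps_nth (signof p * F) k = signof p * fps_nth F k" for p :: "nat \<Rightarrow> nat" and F :: "rat fps" and k
    by (cases "sign p = 1") (auto simp: sign_def)
  show ?thesis
    unfolding D by (simp add: fps_sum_nth sg fps_nth_compose_X_power)
qed

text \<open>For fixed \<open>p\<close> the Leibniz term is a product over the letters, so
  \<open>sum_words_egf\<close> applies and yields the same factors as
  \<open>det_I_series_nth\<close>.\<close>

lemma sum_words_fact_det:
  "(\<Sum>w | set w \<subseteq> {..<m} \<and> length w = n. fact_det m (coords w)) =
   fact n * fps_nth (det (mat m m (\<lambda>(i, j). I_series (int i - int j)))) (2 * n)"
proof -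
  have "(\<Sum>w | set w \<subseteq> {..<m} \<and> length w = n. fact_det m (coords w)) =
    (\<Sum>p | p permutes {0..<m}. signof p * (\<Sum>w | set w \<subseteq> {..<m} \<and> length w = n.
       \<Prod>i<m. inv_fact (int (count_list w i) + (int (p i) - int i))))"
    unfolding fact_det_Leibniz sum_distrib_left coords_def
    by (subst sum.swap) (simp add: algebra_simps)
  also have "\<dots> = fact n * fps_nth (det (mat m m (\<lambda>(i, j). I_series (int i - int j)))) (2 * n)"
    by (simp add: det_I_series_nth sum_distrib_left mult.left_commute
      sum_words_egf[where a = "\<lambda>i k. inv_fact (int k + (int (p i) - int i))" for p])
  finally show ?thesis .
qed

subsection \<open>Counting\<close>

lemma length_word_delete: "ballot w \<Longrightarrow> removable w e \<Longrightarrow> length w = Suc (length (fst (word_delete w e)))"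
  using word_delete_correct(1,3,4)[of w e, OF _ _ prod.collapse[symmetric]] word_insert_correct(3) by blast

lemma coords_word_delete:
  assumes "ballot w" "removable w e"
  shows "coords (fst (word_delete w e)) = (coords w)(e := coords w e - 1)"
proof
  fix j
  show "coords (fst (word_delete w e)) j = ((coords w)(e := coords w e - 1)) j"
    using word_delete_correct(2)[of w e, OF assms prod.collapse[symmetric], of j]
    by (cases "j = e") (auto simp: coords_def)
qed

lemma set_word_delete_subset:
  assumes "ballot w" "removable w e"
  shows "set (fst (word_delete w e)) \<subseteq> set w"
proof
  fix j assume "j \<in> set (fst (word_delete w e))"
  then show "j \<in> set w"
    using word_delete_correct(2)[of w e, OF assms prod.collapse[symmetric], of j]
      count_list_0_iff[of w j] count_list_0_iff[of "fst (word_delete w e)" j] by (auto split: if_splits)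
qed

text \<open>Either column \<open>e + 1\<close> has the same height, and lowering \<open>e\<close>
  makes two shifted coordinates equal; or \<open>e\<close> is the last column and empty, and its row
  becomes zero.\<close>

lemma fact_det_not_removable:
  assumes "ballot w" "set w \<subseteq> {..<m}" "e < m" "\<not> removable w e"
  shows "fact_det m ((coords w)(e := coords w e - 1)) = 0"
proof -
  have eq: "count_list w (Suc e) = count_list w e"
    using antimonoD[OF ballot_antimono[OF assms(1)], of e "Suc e"] assms(4)
    by (simp add: removable_def)
  show ?thesis
  proof (cases "Suc e < m")
    case True
    then show ?thesis
      using eq by (intro antisym_fun_zero[OF antisym_fact_det, of e m "Suc e"]) (auto simp: coords_def)
  next
    case False
    then have m: "m = Suc e"
      using assms(3) by simp
    then have "Suc e \<notin> set w"
      using assms(2) by auto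
    then have "count_list w e = 0"
      using eq by simp
    then show ?thesis
      using m by (intro fact_det_zero_row[of e]) (auto simp: coords_def)
  qed
qed

text \<open>Both sides obey the same recursion: the sum over removable columns extends to all
  \<open>e < m\<close> because the other terms vanish, and \<open>fact_det_down_sum\<close>
  evaluates it.\<close>

lemma card_word_of:
  "ballot w \<Longrightarrow> set w \<subseteq> {..<m} \<Longrightarrow> length w = n \<Longrightarrow>
     of_nat (card {ks \<in> gaps n. word_of ks = w}) = fact n * fact_det m (coords w)"
proof (induction n arbitrary: w)
  case 0
  then have w: "w = []"
    by simp
  have "{ks \<in> gaps 0. word_of ks = w} = {[]}"
    by (auto simp: w)
  moreover have "coords w = (\<lambda>i. - int i)"
    by (simp add: coords_def fun_eq_iff w)
  ultimately show ?case
    by (simp only: fact_det_origin) simp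
next
  case (Suc n)
  let ?G = "\<lambda>e. fact_det m ((coords w)(e := coords w e - 1))"
  have IH: "of_nat (card {ks \<in> gaps n. word_of ks = fst (word_delete w e)}) = fact n * ?G e"
    if "removable w e" for e
  proof -
    have "ballot (fst (word_delete w e))"
      by (rule word_delete_correct(1)[OF Suc.prems(1) that prod.collapse[symmetric]])
    moreover have "set (fst (word_delete w e)) \<subseteq> {..<m}"
      using set_word_delete_subset[OF Suc.prems(1) that] Suc.prems(2) by (rule subset_trans)
    moreover have "length (fst (word_delete w e)) = n"
      using length_word_delete[OF Suc.prems(1) that] Suc.prems(3) by simp
    ultimately show ?thesis
      unfolding coords_word_delete[OF Suc.prems(1) that, symmetric] by (rule Suc.IH)
  qed
  have "of_nat (card {ks \<in> gaps (Suc n). word_of ks = w}) = (\<Sum>e | removable w e. fact n * ?G e)"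
    unfolding card_word_of_rec[OF Suc.prems(1,3)] of_nat_sum by (intro sum.cong) (auto simp: IH)
  also have "\<dots> = (\<Sum>e<m. fact n * ?G e)"
  proof (rule sum.mono_neutral_left)
    show "{e. removable w e} \<subseteq> {..<m}"
      using removable_in_set Suc.prems(2) by auto
    show "\<forall>e\<in>{..<m} - {e. removable w e}. fact n * ?G e = 0"
      using fact_det_not_removable[OF Suc.prems(1,2)] by simp
  qed simp
  also have "\<dots> = fact n * (of_int (\<Sum>i<m. coords w i + int i) * fact_det m (coords w))"
    by (simp add: fact_det_down_sum flip: sum_distrib_left)
  \<comment> \<open>The column heights add up to the number of boxes, the factor that turns
    \<open>fact n\<close> into \<open>fact (Suc n)\<close>.\<close>
  also have "(\<Sum>i<m. coords w i + int i) = int (Suc n)"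
    using sum_count_set[OF Suc.prems(2)] Suc.prems(3) by (simp add: coords_def flip: of_nat_sum)
  finally show ?case
    by (simp add: algebra_simps)
qed

section \<open>From ballot words to all words, and the count of avoiding permutations\<close>

lemma finite_words: "finite {w. set w \<subseteq> {..<m::nat} \<and> length w = n}"
  by (rule finite_lists_length_eq) simp

lemma coords_Cons: "coords (c # w) = (coords w)(c := coords w c + 1)"
  by (auto simp: coords_def fun_eq_iff)

text \<open>
  The reflection principle: an alternating function vanishes on the first step out of the chamber.
\<close>

lemma sum_ballot_words:
  "antisym_fun m G \<Longrightarrow>
     (\<Sum>w | ballot w \<and> set w \<subseteq> {..<m} \<and> length w = n. G (coords w)) =
     (\<Sum>w | set w \<subseteq> {..<m} \<and> length w = n. G (coords w))"
proof (induction n arbitrary: G)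
  case 0
  have "{w. ballot w \<and> set w \<subseteq> {..<m} \<and> length w = 0} = {w. set w \<subseteq> {..<m} \<and> length w = 0}"
    by auto
  then show ?case
    by simp
next
  case (Suc n)
  have zero: "G (coords (c # w)) = 0" if "ballot w" "c < m" "\<not> ballot (c # w)" for w c
  proof -
    note am = ballot_antimono[OF that(1)]
    have "\<not> antimono (count_list (c # w))"
      using that by (simp del: count_list.simps)
    then obtain j where j: "j < c" "count_list w j \<le> count_list w c"
      unfolding antimono_Cons_iff[OF am] using leI by blast
    then obtain i where i: "c = Suc i" "j \<le> i"
      by (cases c) auto
    \<comment> \<open>A forbidden letter \<open>c\<close> has a left neighbour
      \<open>i = c - 1\<close> of equal height, so after the step the shifted coordinates of
      \<open>i\<close> and \<open>c\<close> coincide.\<close>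
    have "count_list w i = count_list w c"
      using antimonoD[OF am, of j i] antimonoD[OF am, of i c] i j by simp
    then have "coords (c # w) c = coords (c # w) i"
      using i by (simp add: coords_def)
    then show ?thesis
      using that(2) i by (intro antisym_fun_zero[OF Suc.prems, of c i]) auto
  qed
  let ?g = "\<lambda>w. if ballot w then G (coords w) else 0"
  have step: "(\<Sum>c<m. ?g (c # w)) = (if ballot w then \<Sum>c<m. G (coords (c # w)) else 0)" for w
  proof (cases "ballot w")
    case True
    then have "(\<Sum>c<m. ?g (c # w)) = (\<Sum>c<m. G (coords (c # w)))"
      using zero by (intro sum.cong) auto
    then show ?thesis
      using True by simp
  qed simp
  have "(\<Sum>w | ballot w \<and> set w \<subseteq> {..<m} \<and> length w = Suc n. G (coords w)) =
    (\<Sum>w | set w \<subseteq> {..<m} \<and> length w = Suc n. ?g w)"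
    by (rule sum.mono_neutral_cong_left[OF finite_words]) auto
  also have "\<dots> = (\<Sum>w | set w \<subseteq> {..<m} \<and> length w = n. \<Sum>c<m. ?g (c # w))"
    by (rule sum_lists_Suc)
  also have "\<dots> = (\<Sum>w | ballot w \<and> set w \<subseteq> {..<m} \<and> length w = n. \<Sum>c<m. G (coords (c # w)))"
    unfolding step by (rule sum.mono_neutral_cong_right[OF finite_words]) auto
  \<comment> \<open>The most recent letter moves into the summed function, so the induction
    hypothesis is used for \<open>up_sum m G\<close>.\<close>
  also have "\<dots> = (\<Sum>w | ballot w \<and> set w \<subseteq> {..<m} \<and> length w = n. up_sum m G (coords w))"
    by (simp add: up_sum_def coords_Cons)
  also have "\<dots> = (\<Sum>w | set w \<subseteq> {..<m} \<and> length w = n. up_sum m G (coords w))"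
    by (rule Suc.IH[OF antisym_up_sum[OF Suc.prems]])
  also have "\<dots> = (\<Sum>w | set w \<subseteq> {..<m} \<and> length w = Suc n. G (coords w))"
    by (simp add: sum_lists_Suc up_sum_def coords_Cons)
  finally show ?case .
qed

text \<open>One factor \<open>fact n\<close> comes from the count of histories per ballot word, the
  other from the exponential generating function of words.\<close>

lemma card_avoiding_gaps:
  "of_nat (card {ks \<in> gaps n. set (word_of ks) \<subseteq> {..<m}}) =
     (fact n)\<^sup>2 * fps_nth (det (mat m m (\<lambda>(i, j). I_series (int i - int j)))) (2 * n)"
proof -
  let ?W = "{w. ballot w \<and> set w \<subseteq> {..<m} \<and> length w = n}"
  have fin: "finite ?W"
    by (rule finite_subset[OF _ finite_words[of m n]]) auto
  have "{ks \<in> gaps n. set (word_of ks) \<subseteq> {..<m}} = (\<Union>w\<in>?W. {ks \<in> gaps n. word_of ks = w})"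
    using word_of_gaps by auto
  then have "card {ks \<in> gaps n. set (word_of ks) \<subseteq> {..<m}} =
      (\<Sum>w\<in>?W. card {ks \<in> gaps n. word_of ks = w})"
    using fin by (simp only:) (rule card_UN_disjoint, auto)
  then have "of_nat (card {ks \<in> gaps n. set (word_of ks) \<subseteq> {..<m}}) =
      (\<Sum>w\<in>?W. fact n * fact_det m (coords w))"
    by (simp add: card_word_of[where m = m])
  also have "\<dots> = fact n * (\<Sum>w | set w \<subseteq> {..<m} \<and> length w = n. fact_det m (coords w))"
    by (simp add: sum_ballot_words[OF antisym_fact_det] flip: sum_distrib_left)
  finally show ?thesis
    by (simp add: sum_words_fact_det power2_eq_square)
qed

text \<open>An ascending subsequence of length \<open>m + 1\<close> exists iff the letter
  \<open>m\<close> occurs, and as the letters form an initial segment this means that some letter is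
  at least \<open>m\<close>.\<close>

lemma card_avoiding:
  "of_nat (card {\<tau> \<in> permutations_of_set {1..n}. \<not> has_ascending_subseq (m + 1) \<tau>}) =
     (fact n)\<^sup>2 * fps_nth (det (mat m m (\<lambda>(i, j). I_series (int i - int j)))) (2 * n)"
proof -
  have av: "has_ascending_subseq (m + 1) (rev (perm_of ks)) \<longleftrightarrow> \<not> set (word_of ks) \<subseteq> {..<m}"
    if ks: "ks \<in> gaps n" for ks
  proof -
    have "has_ascending_subseq (m + 1) (rev (perm_of ks)) \<longleftrightarrow> m \<in> set (word_of ks)"
      using has_desc_subseq_iff_letter[OF ks, of m 0] by (simp add: has_ascending_subseq_rev)
    also have "\<dots> \<longleftrightarrow> \<not> set (word_of ks) \<subseteq> {..<m}"
      using ballot_down_closed[of "word_of ks" _ m] word_of_gaps[OF ks]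
      by (metis leI lessThan_iff less_irrefl subsetD subsetI)
    finally show ?thesis .
  qed
  have bij: "bij_betw (rev \<circ> perm_of) (gaps n) (permutations_of_set {1..n})"
    by (rule bij_betw_trans[OF bij_betw_perm_of]) (simp add: bij_betw_def)
  have "bij_betw (rev \<circ> perm_of) {ks \<in> gaps n. set (word_of ks) \<subseteq> {..<m}}
      {\<tau> \<in> permutations_of_set {1..n}. \<not> has_ascending_subseq (m + 1) \<tau>}"
    using bij_betw_Collect[OF bij, of "\<lambda>\<tau>. \<not> has_ascending_subseq (m + 1) \<tau>"
        "\<lambda>ks. set (word_of ks) \<subseteq> {..<m}"] av by auto
  then show ?thesis
    by (simp add: bij_betw_same_card[symmetric] card_avoiding_gaps)
qed

theorem theorem1:
  fixes m :: nat
  assumes "m \<ge> 1"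
  shows "((\<lambda>\<tau>. fps_const (1 / (fact (length \<tau>))\<^sup>2) * fps_X ^ (2 * length \<tau>)) has_sum
           det (mat m m (\<lambda>(i, j). I_series (int i - int j)))) (perms_avoiding m)"
proof -
  let ?f = "\<lambda>\<tau>::nat list. fps_const (1 / (fact (length \<tau>))\<^sup>2) * fps_X ^ (2 * length \<tau>) :: rat fps"
  let ?D = "det (mat m m (\<lambda>(i, j). I_series (int i - int j)))"
  let ?P = "\<lambda>n. {\<tau> \<in> permutations_of_set {1..n}. \<not> has_ascending_subseq (m + 1) \<tau>}"
  have f: "fps_nth (?f \<tau>) k = (if k = 2 * length \<tau> then 1 / (fact (length \<tau>))\<^sup>2 else 0)" for \<tau> k
    by simp
  have len: "length \<tau> = n" if "\<tau> \<in> ?P n" for \<tau> n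
    using that length_finite_permutations_of_set[of \<tau> "{1..n}"] by simp
  \<comment> \<open>The coefficient of degree \<open>k\<close> only sees permutations of length
    \<open>k div 2\<close> with \<open>k\<close> even, so finitely many.\<close>
  have S: "{\<tau> \<in> perms_avoiding m. fps_nth (?f \<tau>) k \<noteq> 0} = (if even k then ?P (k div 2) else {})" for k
  proof -
    have "\<tau> \<in> perms_avoiding m \<and> k = 2 * length \<tau> \<longleftrightarrow> even k \<and> \<tau> \<in> ?P (k div 2)" for \<tau>
      using len unfolding perms_avoiding_def by fastforce
    then show ?thesis
      unfolding f by (auto split: if_splits)
  qed
  have "finite {\<tau> \<in> perms_avoiding m. fps_nth (?f \<tau>) k \<noteq> 0}" for k
    unfolding S by simp
  then have "(?f has_sum Abs_fps (\<lambda>k. \<Sum>\<tau> | \<tau> \<in> perms_avoiding m \<and> fps_nth (?f \<tau>) k \<noteq> 0.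
      fps_nth (?f \<tau>) k)) (perms_avoiding m)"
    by (rule has_sum_fps)
  also have "Abs_fps (\<lambda>k. \<Sum>\<tau> | \<tau> \<in> perms_avoiding m \<and> fps_nth (?f \<tau>) k \<noteq> 0. fps_nth (?f \<tau>) k) = ?D"
  proof (rule fps_ext)
    fix k
    show "fps_nth (Abs_fps (\<lambda>k. \<Sum>\<tau> | \<tau> \<in> perms_avoiding m \<and> fps_nth (?f \<tau>) k \<noteq> 0.
      fps_nth (?f \<tau>) k)) k = fps_nth ?D k"
    proof (cases "even k")
      case False
      then show ?thesis
        unfolding fps_nth_Abs_fps S by (simp add: det_I_series_nth)
    next
      case True
      then obtain n where k: "k = 2 * n"
        by (elim evenE)
      have "(\<Sum>\<tau>\<in>?P n. fps_nth (?f \<tau>) k) = (\<Sum>\<tau>\<in>?P n. 1 / (fact n)\<^sup>2)"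
        unfolding f using len k by (intro sum.cong) auto
      also have "\<dots> = fps_nth ?D k"
        by (simp only: sum_constant card_avoiding k) simp
      finally show ?thesis
        unfolding fps_nth_Abs_fps S using k by simp
    qed
  qed
  finally show ?thesis .
qed

end
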